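(* Let $\mathbf T\in\mathbb R^{[d,n]}$ be a nonzero entrywise nonnegative square tensor with $d$ modes, let $C_+(\mathbf T)$ and $k_0=k_0(\mathbf T)$ be the associated cone and integer, and let $p>d$. Then there exists a unique $\ell^p$-eigenvector $\mathbf u$ of $\mathbf T$ lying in $C_+(\mathbf T)$, i.e. a unique $\mathbf u\in C_+(\mathbf T)$ such that $\|\mathbf u\|_p=1$ and $T(\mathbf u)=\lambda\,\Phi_p(\mathbf u)$ for some $\lambda\in\mathbb R$ (it is called the Perron $\ell^p$-eigenvector). In particular, for any $\sigma\ge 0$ and any entrywise positive $\mathbf x_0\in\mathbb R^n$, the sequences $(\lambda_k)$ and $(\mathbf x_k)$ defined by either Algorithm 1 or Algorithm 2 are such that: 1. $\mathbf x_k\in C_+(\mathbf T)$ for all $k\ge k_0$; 2. $(\mathbf x_k)$ converges to the Perron $\ell^p$-eigenvector $\mathbf u$ of $\mathbf T$ in $C_+(\mathbf T)$, with $\|\mathbf u\|_p=1$; 3. $(\lambda_k)$ converges to the $\ell^p$-eigenvalue $\lambda>0$ of $\mathbf T$ corresponding to $\mathbf u$.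
   Context: $\mathbb R^{[d,n]}$ is the set of real tensors $\mathbf T=(t_{i_1,\dots,i_d})$ with $d$ modes, each of dimension $n$. Associated map $T:\mathbb R^n\to\mathbb R^n$, $T(\mathbf x)_{i_1}=\sum_{i_2,\dots,i_d}t_{i_1,i_2,\dots,i_d}x_{i_2}\cdots x_{i_d}$; $T^k$ is the $k$-fold composition of $T$. For $1<p<\infty$, $\|\mathbf x\|_p=(\sum_i|x_i|^p)^{1/p}$ and $\Phi_p(\mathbf x)_i=\operatorname{sign}(x_i)|x_i|^{p-1}$. A real $\lambda$ is an $\ell^p$-eigenvalue of $\mathbf T$ with $\ell^p$-eigenvector $\mathbf x\in\mathbb R^n$ if $T(\mathbf x)=\lambda\Phi_p(\mathbf x)$ and $\|\mathbf x\|_p=1$. Let $f_p(\mathbf x)=\mathbf x^TT(\mathbf x)/\|\mathbf x\|_p^d$. Cone: let $\mathbb 1$ be the all-ones vector and, for $k\ge1$, $C_+^k=\{\mathbf x\ge 0:\ c_1\mathbf x\le T^k(\mathbb 1)\le c_2\mathbf x \text{ for some } c_1,c_2>0\}$ (entrywise inequalities), i.e. the nonnegative vectors having the same zero pattern as $T^k(\mathbb 1)$. For a nonzero $\mathbf T\ge0$, $C_+(\mathbf T)=\bigcap_{k\ge k_0}C_+^k$, where $k_0=k_0(\mathbf T)$ is the smallest integer $k_0\geq 1$ for which this intersection is nonempty. Algorithms: let $q=p/(p-1)$, $\sigma\ge0$, $\mathbf x_0>0$. For $k=0,1,2,\dots$ put $\mathbf z=T(\mathbf x_k)$ and then compute $\mathbf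 y$ by Algorithm 1: $\mathbf y=\Phi_q(\mathbf z)+\sigma\,\operatorname{sign}(\mathbf z)\circ\mathbf x_k$; Algorithm 2: $\mathbf y=\Phi_q\big(\mathbf z+\sigma\,\operatorname{sign}(\mathbf z)\circ\Phi_p(\mathbf x_k)\big)$; and in both cases set $\mathbf x_{k+1}=\mathbf y/\|\mathbf y\|_p$, $\lambda_{k+1}=f_p(\mathbf x_{k+1})$. Here $\circ$ is the entrywise product and $\operatorname{sign}$ acts entrywise with $\operatorname{sign}(0)=0$. The sequences are the infinite ones obtained by iterating without a stopping criterion.
   Formalization: The formal theorem additionally assumes C_+(T) ≠ {0}, i.e. T^k(1) is nonzero for every k; without this the claim fails, e.g. for d = n = 2, T = [[0,1],[0,0]], where C_+(T) = {0} contains no vector of norm 1. *)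

theory Defs
  imports "HOL-Analysis.Analysis"
begin

text \<open>
  A tensor with d modes, each of dimension n = CARD('n), is given by its entries: the entry
  with index (i1, ..., id) is the value at the list [i1, ..., id]. Only lists of length d are
  entries; values at other lists are never used.
\<close>

type_synonym 'n tensor = "'n list \<Rightarrow> real"

definition tensor_nonneg :: "nat \<Rightarrow> 'n tensor \<Rightarrow> bool" where
  "tensor_nonneg d T \<longleftrightarrow> (\<forall>is. length is = d \<longrightarrow> 0 \<le> T is)"

definition tensor_nonzero :: "nat \<Rightarrow> 'n tensor \<Rightarrow> bool" where
  "tensor_nonzero d T \<longleftrightarrow> (\<exists>is. length is = d \<and> T is \<noteq> 0)"

definition tensor_map :: "nat \<Rightarrow> 'n::finite tensor \<Rightarrow> real ^ 'n \<Rightarrow> real ^ 'n" where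
  "tensor_map d T x = (\<chi> i. \<Sum>js\<in>{js. length js = d - 1}. T (i # js) * (\<Prod>j\<leftarrow>js. x $ j))"

definition lp_norm :: "real \<Rightarrow> real ^ 'n::finite \<Rightarrow> real" where
  "lp_norm p x = (\<Sum>i\<in>UNIV. \<bar>x $ i\<bar> powr p) powr (1 / p)"

definition Phi :: "real \<Rightarrow> real ^ 'n::finite \<Rightarrow> real ^ 'n" where
  "Phi p x = (\<chi> i. sgn (x $ i) * \<bar>x $ i\<bar> powr (p - 1))"

definition lp_eigenpair :: "nat \<Rightarrow> real \<Rightarrow> 'n::finite tensor \<Rightarrow> real \<Rightarrow> real ^ 'n \<Rightarrow> bool" where
  "lp_eigenpair d p T \<mu> x \<longleftrightarrow> tensor_map d T x = \<mu> *\<^sub>R Phi p x \<and> lp_norm p x = 1"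

definition f_quot :: "nat \<Rightarrow> real \<Rightarrow> 'n::finite tensor \<Rightarrow> real ^ 'n \<Rightarrow> real" where
  "f_quot d p T x = (x \<bullet> tensor_map d T x) / lp_norm p x ^ d"

text \<open>
  The order on vectors is the entrywise one, and \<open>1\<close> is the all-ones vector. If the \<open>k\<close>-fold
  image of the all-ones vector is zero, then \<open>C_pow d T k\<close> is \<open>{0}\<close> and not empty.
\<close>

definition C_pow :: "nat \<Rightarrow> 'n::finite tensor \<Rightarrow> nat \<Rightarrow> (real ^ 'n) set" where
  "C_pow d T k = {x. 0 \<le> x \<and> (\<exists>c\<^sub>1>0. \<exists>c\<^sub>2>0.
     c\<^sub>1 *\<^sub>R x \<le> (tensor_map d T ^^ k) 1 \<and> (tensor_map d T ^^ k) 1 \<le> c\<^sub>2 *\<^sub>R x)}"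

definition k_zero :: "nat \<Rightarrow> 'n::finite tensor \<Rightarrow> nat" where
  "k_zero d T = (LEAST k\<^sub>0. 1 \<le> k\<^sub>0 \<and> (\<Inter>k\<in>{k\<^sub>0..}. C_pow d T k) \<noteq> {})"

definition C_plus :: "nat \<Rightarrow> 'n::finite tensor \<Rightarrow> (real ^ 'n) set" where
  "C_plus d T = (\<Inter>k\<in>{k_zero d T..}. C_pow d T k)"

definition sign_mult :: "real ^ 'n::finite \<Rightarrow> real ^ 'n \<Rightarrow> real ^ 'n" where
  "sign_mult z x = (\<chi> i. sgn (z $ i) * x $ i)"

definition step1 :: "nat \<Rightarrow> real \<Rightarrow> 'n::finite tensor \<Rightarrow> real \<Rightarrow> real ^ 'n \<Rightarrow> real ^ 'n" where
  "step1 d p T \<sigma> x =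
     (let q = p / (p - 1);
          z = tensor_map d T x;
          y = Phi q z + \<sigma> *\<^sub>R sign_mult z x
      in y /\<^sub>R lp_norm p y)"

definition step2 :: "nat \<Rightarrow> real \<Rightarrow> 'n::finite tensor \<Rightarrow> real \<Rightarrow> real ^ 'n \<Rightarrow> real ^ 'n" where
  "step2 d p T \<sigma> x =
     (let q = p / (p - 1);
          z = tensor_map d T x;
          y = Phi q (z + \<sigma> *\<^sub>R sign_mult z (Phi p x))
      in y /\<^sub>R lp_norm p y)"

end

theory Submission
  imports Defs
begin

text \<open>
  Everything a nonnegative tensor does to zero patterns is decided by supports: the support of
  \<open>T(x)\<close> depends, monotonically, only on the support of \<open>x \<ge> 0\<close>. Starting from the full index
  set the supports of \<open>T\<^sup>k(1)\<close> therefore decrease and become constant, with value \<open>S\<close> say, so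
  \<open>C_plus\<close> consists of the nonnegative vectors with support exactly \<open>S\<close>
  (\<open>C_plus_iff_supp\<close>). This relatively open face is mapped into itself by \<open>T\<close>, and on it any two
  vectors are comparable up to positive factors. Moreover \<open>S\<close> is nonempty because the cone is
  not \<open>{0}\<close>. What remains is a Perron theorem on this face, where the decisive fact is that
  \<open>T\<close> is homogeneous of degree \<open>d - 1\<close> and \<open>\<Phi>\<^sub>p\<close> of the larger degree \<open>p - 1\<close>; put
  \<open>r = (d - 1) / (p - 1) < 1\<close>.

  Existence (\<open>ex_eigenpair\<close>): because of the gap in degrees, a large multiple of the indicator
  of \<open>S\<close> is moved down and a small one is moved up by the order preserving map
  \<open>x \<mapsto> T(x)\<^bsup>1/(p-1)\<^esup>\<close>. Iterating from the large multiple gives a decreasing sequence that stays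
  above the small one; its limit is a fixed point in the face, and a multiple of it is the
  eigenvector.

  Convergence (\<open>damped_iteration_converges\<close>): both algorithms are instances of one iteration,
  \<open>y\<^sup>a = T(x)\<^bsup>a/(p-1)\<^esup> + \<sigma> x\<^sup>a\<close> on the support of \<open>T(x)\<close>, followed by normalisation, with
  \<open>a = 1\<close> and \<open>a = p - 1\<close> respectively. Measure the distance of \<open>x\<close> to an eigenvector
  \<open>u\<close> with eigenvalue \<open>\<mu>\<close> by the ratio \<open>M / m\<close> of factors with \<open>m u \<le> x \<le> M u\<close>, as in
  Hilbert's projective metric. The term \<open>\<sigma> x\<^sup>a\<close> spoils the homogeneity of the map, but
  since \<open>x\<close> and \<open>u\<close> have the same norm, \<open>m \<le> 1 \<le> M\<close>, and this suffices to show that one step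
  turns the bound \<open>R\<close> for \<open>(M / m)\<^sup>a\<close> into the weighted mean of \<open>R\<^sup>r\<close> and \<open>R\<close> with weights
  proportional to \<open>\<mu>\<^bsup>a/(p-1)\<^esup>\<close> and \<open>\<sigma>\<close> (\<open>damped_map_contraction\<close>). Iterating this scalar map
  drives \<open>R\<close> to 1, which forces \<open>x\<^sub>k\<close> to \<open>u\<close>. Uniqueness comes for free: another normalised
  eigenvector is a fixed point of the undamped iteration, so the constant sequence at it
  converges to \<open>u\<close>.
\<close>

section \<open>Nonnegative vectors and their supports\<close>

definition supp :: "real ^ 'n \<Rightarrow> 'n set" where
  "supp x = {i. x $ i \<noteq> 0}"

text \<open>
  There are finitely many coordinates, so the least of the quotients \<open>y\<^sub>i / x\<^sub>i\<close> is a common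
  positive factor. This turns the inequalities with constants that define the cone into
  statements about supports.
\<close>
lemma supp_subset_iff_scaled_le:
  fixes x y :: "real ^ 'n::finite"
  assumes "0 \<le> x" "0 \<le> y"
  shows "supp x \<subseteq> supp y \<longleftrightarrow> (\<exists>c>0. c *\<^sub>R x \<le> y)"
proof
  assume sub: "supp x \<subseteq> supp y"
  \<comment> \<open>The entry 1 only keeps the set nonempty when \<open>x = 0\<close>.\<close>
  define c where "c = Min (insert 1 ((\<lambda>i. y $ i / x $ i) ` supp x))"
  have pos: "x $ i > 0" "y $ i > 0" if "i \<in> supp x" for i
    using that sub assms by (auto simp: supp_def less_eq_vec_def order.order_iff_strict)
  have "c > 0" unfolding c_def using pos by (subst Min_gr_iff) auto
  moreover have "c * x $ i \<le> y $ i" for i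
  proof (cases "i \<in> supp x")
    case True
    then have "c \<le> y $ i / x $ i" unfolding c_def by (intro Min_le) auto
    with pos[OF True] show ?thesis by (simp add: field_simps)
  next
    case False
    then show ?thesis using assms by (simp add: supp_def less_eq_vec_def)
  qed
  ultimately show "\<exists>c>0. c *\<^sub>R x \<le> y" by (auto simp: less_eq_vec_def)
next
  assume "\<exists>c>0. c *\<^sub>R x \<le> y"
  then obtain c where c: "c > 0" "\<And>i. c * x $ i \<le> y $ i" by (auto simp: less_eq_vec_def)
  show "supp x \<subseteq> supp y"
  proof
    fix i assume "i \<in> supp x"
    then have "0 < x $ i"
      using assms(1) by (auto simp: supp_def less_eq_vec_def order.order_iff_strict)
    then have "0 < c * x $ i" using c(1) by simp
    with c(2)[of i] show "i \<in> supp y" by (simp add: supp_def)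
  qed
qed

lemma supp_scaleR [simp]: "c \<noteq> 0 \<Longrightarrow> supp (c *\<^sub>R x) = supp x"
  by (simp add: supp_def)

section \<open>The map of a nonnegative tensor\<close>

lemma prod_list_mono_nonneg:
  fixes f g :: "'a \<Rightarrow> real"
  assumes "\<And>j. 0 \<le> f j" "\<And>j. f j \<le> g j"
  shows "0 \<le> (\<Prod>j\<leftarrow>js. f j) \<and> (\<Prod>j\<leftarrow>js. f j) \<le> (\<Prod>j\<leftarrow>js. g j)"
  by (induction js) (use assms in \<open>auto intro!: mult_mono intro: order_trans\<close>)

lemma prod_list_scale:
  "(\<Prod>j\<leftarrow>js. c * f j :: real) = c ^ length js * (\<Prod>j\<leftarrow>js. f j)"
  by (induction js) auto

lemma tendsto_prod_list:
  fixes f :: "'b \<Rightarrow> 'a \<Rightarrow> real"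
  assumes "\<And>j. ((\<lambda>t. f t j) \<longlongrightarrow> g j) F"
  shows "((\<lambda>t. \<Prod>j\<leftarrow>js. f t j) \<longlongrightarrow> (\<Prod>j\<leftarrow>js. g j)) F"
  by (induction js) (auto intro!: tendsto_mult assms)

lemma tensor_map_nonneg:
  assumes "1 \<le> d" "tensor_nonneg d T" "0 \<le> x"
  shows "0 \<le> tensor_map d T x"
  unfolding less_eq_vec_def tensor_map_def
proof (intro allI, simp, intro sum_nonneg mult_nonneg_nonneg)
  fix i and js :: "'a list" assume "js \<in> {js. length js = d - Suc 0}"
  then show "0 \<le> T (i # js)" using assms by (auto simp: tensor_nonneg_def)
  show "0 \<le> (\<Prod>j\<leftarrow>js. x $ j)"
    using prod_list_mono_nonneg[of "\<lambda>j. x $ j"] assms(3) by (auto simp: less_eq_vec_def)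
qed

lemma tensor_map_mono:
  assumes "1 \<le> d" "tensor_nonneg d T" "0 \<le> x" "x \<le> y"
  shows "tensor_map d T x \<le> tensor_map d T y"
  unfolding less_eq_vec_def tensor_map_def
proof (intro allI, simp, intro sum_mono mult_left_mono)
  fix i and js :: "'a list" assume "js \<in> {js. length js = d - Suc 0}"
  then show "0 \<le> T (i # js)" using assms by (auto simp: tensor_nonneg_def)
  show "(\<Prod>j\<leftarrow>js. x $ j) \<le> (\<Prod>j\<leftarrow>js. y $ j)"
    using prod_list_mono_nonneg[of "\<lambda>j. x $ j" "\<lambda>j. y $ j"] assms(3,4)
    by (auto simp: less_eq_vec_def)
qed

lemma tensor_map_scaleR:
  "tensor_map d T (c *\<^sub>R x) = c ^ (d - 1) *\<^sub>R tensor_map d T x"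
  by (auto simp: tensor_map_def vec_eq_iff prod_list_scale sum_distrib_left intro!: sum.cong)

lemma tendsto_tensor_map:
  assumes "(X \<longlongrightarrow> x) F"
  shows "((\<lambda>t. tensor_map d T (X t)) \<longlongrightarrow> tensor_map d T x) F"
  unfolding tensor_map_def
  by (intro vec_tendstoI, simp, intro tendsto_sum tendsto_mult tendsto_const
      tendsto_prod_list tendsto_vec_nth assms)

text \<open>
  Monotonicity alone does not give this, because the entries of \<open>x\<close> may exceed those of \<open>y\<close>;
  homogeneity allows \<open>x\<close> to be shrunk below \<open>y\<close> first.
\<close>
lemma supp_tensor_map_mono:
  assumes "1 \<le> d" "tensor_nonneg d T" "0 \<le> x" "0 \<le> y" "supp x \<subseteq> supp y"
  shows "supp (tensor_map d T x) \<subseteq> supp (tensor_map d T y)"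
proof -
  obtain c where c: "c > 0" "c *\<^sub>R x \<le> y"
    using assms supp_subset_iff_scaled_le by blast
  have "c ^ (d - 1) *\<^sub>R tensor_map d T x \<le> tensor_map d T y"
    using tensor_map_mono[OF assms(1,2) _ c(2)] c(1) assms(3)
    by (simp add: tensor_map_scaleR less_eq_vec_def)
  moreover have "0 < c ^ (d - 1)" using c(1) by simp
  ultimately show ?thesis
    using supp_subset_iff_scaled_le tensor_map_nonneg[OF assms(1,2)] assms(3,4) by blast
qed

section \<open>The norm on nonnegative vectors\<close>

lemma lp_norm_nonneg: "0 \<le> lp_norm p x"
  by (simp add: lp_norm_def)

lemma lp_norm_pos:
  assumes "supp x \<noteq> {}" shows "0 < lp_norm p x"
proof -
  obtain i where "x $ i \<noteq> 0" using assms by (auto simp: supp_def)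
  then have "0 < (\<Sum>i\<in>UNIV. \<bar>x $ i\<bar> powr p)" by (intro sum_pos2[of _ i]) auto
  then show ?thesis by (simp add: lp_norm_def)
qed

lemma lp_norm_scaleR:
  assumes "0 \<le> c" "0 < p"
  shows "lp_norm p (c *\<^sub>R x) = c * lp_norm p x"
  using assms
  by (simp add: lp_norm_def abs_mult powr_mult flip: sum_distrib_left)
     (simp add: powr_mult powr_powr sum_nonneg)

lemma lp_norm_mono:
  assumes "0 < p" "0 \<le> x" "x \<le> y"
  shows "lp_norm p x \<le> lp_norm p y"
proof -
  have "\<bar>x $ i\<bar> \<le> \<bar>y $ i\<bar>" for i
  proof -
    have "0 \<le> x $ i" "x $ i \<le> y $ i" using assms by (auto simp: less_eq_vec_def)
    then show ?thesis by linarith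
  qed
  then show ?thesis unfolding lp_norm_def using assms
    by (intro powr_mono2 sum_mono sum_nonneg) auto
qed

lemma tendsto_f_quot:
  assumes "(X \<longlongrightarrow> u) F" "lp_norm p u = 1" "\<forall>\<^sub>F t in F. lp_norm p (X t) = 1"
  shows "((\<lambda>t. f_quot d p T (X t)) \<longlongrightarrow> f_quot d p T u) F"
proof -
  have "((\<lambda>t. X t \<bullet> tensor_map d T (X t)) \<longlongrightarrow> f_quot d p T u) F"
    using assms by (auto simp: f_quot_def intro!: tendsto_inner tendsto_tensor_map)
  moreover have "\<forall>\<^sub>F t in F. X t \<bullet> tensor_map d T (X t) = f_quot d p T (X t)"
    using assms(3) by eventually_elim (simp add: f_quot_def)
  ultimately show ?thesis by (rule Lim_transform_eventually)
qed

text \<open>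
  Pairing \<open>u\<close> with \<open>\<Phi>\<^sub>p(u)\<close> gives the \<open>p\<close>-th power of the norm, which is 1. Hence the limit
  of the computed quotients is the eigenvalue.
\<close>
lemma f_quot_eigenpair:
  fixes u :: "real ^ 'n::finite"
  assumes "lp_eigenpair d p T \<mu> u" "0 \<le> u" "0 < p"
  shows "f_quot d p T u = \<mu>"
proof -
  have pw: "u $ i * (sgn (u $ i) * \<bar>u $ i\<bar> powr (p - 1)) = \<bar>u $ i\<bar> powr p" for i
  proof -
    have "u $ i \<ge> 0" using assms(2) by (simp add: less_eq_vec_def)
    then show ?thesis by (cases "u $ i = 0") (auto simp: powr_diff)
  qed
  have n1: "lp_norm p u = 1" and e: "tensor_map d T u = \<mu> *\<^sub>R Phi p u"
    using assms by (auto simp: lp_eigenpair_def)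
  have "(\<Sum>i\<in>UNIV. \<bar>u $ i\<bar> powr p) = lp_norm p u powr p"
    using assms(3) by (simp add: lp_norm_def powr_powr sum_nonneg)
  then have one: "(\<Sum>i\<in>UNIV. \<bar>u $ i\<bar> powr p) = 1" using n1 by simp
  have "u \<bullet> tensor_map d T u = \<mu>"
    unfolding e inner_vec_def
    by (simp add: Phi_def mult.left_commute pw one flip: sum_distrib_left)
  then show ?thesis by (simp add: f_quot_def n1)
qed

section \<open>The cone of a nonnegative tensor\<close>

lemma tensor_map_funpow_nonneg:
  assumes "1 \<le> d" "tensor_nonneg d T"
  shows "0 \<le> (tensor_map d T ^^ k) 1"
  by (induction k) (auto intro: tensor_map_nonneg assms simp: less_eq_vec_def[of 0 1])

lemma supp_funpow_antimono:
  assumes "1 \<le> d" "tensor_nonneg d T" "k \<le> l"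
  shows "supp ((tensor_map d T ^^ l) 1) \<subseteq> supp ((tensor_map d T ^^ k) 1)"
proof -
  have "supp ((tensor_map d T ^^ Suc k) 1) \<subseteq> supp ((tensor_map d T ^^ k) 1)" for k
  proof (induction k)
    case 0
    then show ?case by (auto simp: supp_def)
  next
    case (Suc k)
    then show ?case
      using supp_tensor_map_mono[OF assms(1,2) tensor_map_funpow_nonneg[OF assms(1,2)]
          tensor_map_funpow_nonneg[OF assms(1,2)] Suc.IH] by simp
  qed
  then show ?thesis using assms(3) by (rule lift_Suc_antimono_le)
qed

lemma C_pow_iff_supp:
  assumes "1 \<le> d" "tensor_nonneg d T"
  shows "x \<in> C_pow d T k \<longleftrightarrow> 0 \<le> x \<and> supp x = supp ((tensor_map d T ^^ k) 1)"
proof -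
  let ?y = "(tensor_map d T ^^ k) 1"
  have y: "0 \<le> ?y" by (rule tensor_map_funpow_nonneg[OF assms])
  have "(\<exists>c>0. ?y \<le> c *\<^sub>R x) \<longleftrightarrow> (\<exists>c>0. c *\<^sub>R ?y \<le> x)"
  proof safe
    fix c :: real assume "c > 0" "?y \<le> c *\<^sub>R x"
    then show "\<exists>c>0. c *\<^sub>R ?y \<le> x"
      by (intro exI[of _ "inverse c"]) (auto simp: less_eq_vec_def field_simps)
  next
    fix c :: real assume "c > 0" "c *\<^sub>R ?y \<le> x"
    then show "\<exists>c>0. ?y \<le> c *\<^sub>R x"
      by (intro exI[of _ "inverse c"]) (auto simp: less_eq_vec_def field_simps)
  qed
  then show ?thesis
    using supp_subset_iff_scaled_le[of x ?y] supp_subset_iff_scaled_le[of ?y x] y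
    unfolding C_pow_def by blast
qed

text \<open>
  The supports of the iterates form a decreasing chain of finite sets, so from the index of an
  iterate with the fewest nonzero coordinates on they are all equal. Hence the minimum that
  defines \<open>k_zero\<close> is attained.
\<close>
lemma k_zero_C_plus_nonempty:
  fixes T :: "'n::finite tensor"
  assumes "1 \<le> d" "tensor_nonneg d T"
  shows "1 \<le> k_zero d T" "C_plus d T \<noteq> {}"
proof -
  let ?S = "\<lambda>k. supp ((tensor_map d T ^^ k) 1)"
  obtain N where N: "\<And>k. card (?S N) \<le> card (?S k)"
    using ex_has_least_nat[of "\<lambda>_. True" 0 "\<lambda>k. card (?S k)"] by auto
  have eq: "?S k = ?S N" if "N \<le> k" for k
    using supp_funpow_antimono[OF assms that] N[of k]
    by (intro card_seteq) auto
  have "(tensor_map d T ^^ N) 1 \<in> C_pow d T k" if "Suc N \<le> k" for k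
    unfolding C_pow_iff_supp[OF assms] using tensor_map_funpow_nonneg[OF assms] eq[of k] that
    by auto
  then have "1 \<le> Suc N \<and> (\<Inter>k\<in>{Suc N..}. C_pow d T k) \<noteq> {}" by auto
  then have "1 \<le> k_zero d T \<and> (\<Inter>k\<in>{k_zero d T..}. C_pow d T k) \<noteq> {}"
    unfolding k_zero_def by (rule LeastI)
  then show "1 \<le> k_zero d T" "C_plus d T \<noteq> {}" unfolding C_plus_def by auto
qed

lemma supp_funpow_stable:
  assumes "1 \<le> d" "tensor_nonneg d T" "k_zero d T \<le> k"
  shows "supp ((tensor_map d T ^^ k) 1) = supp ((tensor_map d T ^^ k_zero d T) 1)"
proof -
  obtain x where x: "x \<in> C_plus d T" using k_zero_C_plus_nonempty[OF assms(1,2)] by auto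
  have "supp x = supp ((tensor_map d T ^^ k) 1)" if "k_zero d T \<le> k" for k
    using x that C_pow_iff_supp[OF assms(1,2)] unfolding C_plus_def by auto
  then show ?thesis using assms(3) by (metis order_refl)
qed

text \<open>
  A single vector of the intersection has the support of every iterate from \<open>k_zero\<close> on, so
  these supports coincide and the infinitely many conditions reduce to one.
\<close>
lemma C_plus_iff_supp:
  assumes "1 \<le> d" "tensor_nonneg d T"
  shows "x \<in> C_plus d T \<longleftrightarrow> 0 \<le> x \<and> supp x = supp ((tensor_map d T ^^ k_zero d T) 1)"
proof -
  have "x \<in> C_pow d T k \<longleftrightarrow> 0 \<le> x \<and> supp x = supp ((tensor_map d T ^^ k_zero d T) 1)"
    if "k_zero d T \<le> k" for k
    unfolding C_pow_iff_supp[OF assms] supp_funpow_stable[OF assms that] ..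
  then show ?thesis unfolding C_plus_def by auto
qed

section \<open>The damped power step\<close>

text \<open>
  The parameter \<open>a\<close> is the power at which the damping term is added: for nonnegative \<open>x\<close>, the
  first algorithm adds it to the \<open>(p - 1)\<close>-th root of \<open>T(x)\<close>, which is \<open>a = 1\<close>, the second one
  to \<open>T(x)\<close> itself, which is \<open>a = p - 1\<close>.
\<close>
definition damped_map ::
  "real \<Rightarrow> nat \<Rightarrow> real \<Rightarrow> 'n::finite tensor \<Rightarrow> real \<Rightarrow> real ^ 'n \<Rightarrow> real ^ 'n" where
  "damped_map a d p T \<sigma> x =
     (\<chi> i. (tensor_map d T x $ i powr (a / (p - 1)) +
            \<sigma> * (sgn (tensor_map d T x $ i) * x $ i powr a)) powr (1 / a))"

definition damped_step ::
  "real \<Rightarrow> nat \<Rightarrow> real \<Rightarrow> 'n::finite tensor \<Rightarrow> real \<Rightarrow> real ^ 'n \<Rightarrow> real ^ 'n" where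
  "damped_step a d p T \<sigma> x =
     damped_map a d p T \<sigma> x /\<^sub>R lp_norm p (damped_map a d p T \<sigma> x)"

lemma damped_map_nonneg: "0 \<le> damped_map a d p T \<sigma> x"
  by (simp add: damped_map_def less_eq_vec_def)

lemma damped_step_nonneg: "0 \<le> damped_step a d p T \<sigma> x"
  using damped_map_nonneg[of a d p T \<sigma> x]
  by (simp add: damped_step_def less_eq_vec_def lp_norm_nonneg)

lemma Phi_nonneg: "0 \<le> x \<Longrightarrow> Phi r x = (\<chi> i. x $ i powr (r - 1))"
  by (auto simp: Phi_def vec_eq_iff less_eq_vec_def sgn_if order.order_iff_strict)

lemma step1_eq_damped_step:
  assumes "1 \<le> d" "tensor_nonneg d T" "0 \<le> x" "1 < p" "0 \<le> \<sigma>"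
  shows "step1 d p T \<sigma> x = damped_step 1 d p T \<sigma> x"
proof -
  have q: "p / (p - 1) - 1 = 1 / (p - 1)" using assms by (simp add: field_simps)
  have z: "0 \<le> tensor_map d T x" by (rule tensor_map_nonneg) fact+
  have "0 \<le> sgn (tensor_map d T x $ i)" "0 \<le> x $ i" for i
    using z assms(3) by (auto simp: less_eq_vec_def)
  then have "Phi (p / (p - 1)) (tensor_map d T x) + \<sigma> *\<^sub>R sign_mult (tensor_map d T x) x
      = damped_map 1 d p T \<sigma> x"
    using assms(5) z by (simp add: vec_eq_iff Phi_nonneg q sign_mult_def damped_map_def)
  then show ?thesis by (simp add: step1_def damped_step_def Let_def)
qed

lemma step2_eq_damped_step:
  assumes "1 \<le> d" "tensor_nonneg d T" "0 \<le> x" "1 < p" "0 \<le> \<sigma>"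
  shows "step2 d p T \<sigma> x = damped_step (p - 1) d p T \<sigma> x"
proof -
  have q: "p / (p - 1) - 1 = 1 / (p - 1)" using assms by (simp add: field_simps)
  let ?z = "tensor_map d T x"
  have z: "0 \<le> ?z" by (rule tensor_map_nonneg) fact+
  have "0 \<le> ?z + \<sigma> *\<^sub>R sign_mult ?z (Phi p x)"
    using assms z by (auto simp: Phi_nonneg sign_mult_def less_eq_vec_def)
  then have "Phi (p / (p - 1)) (?z + \<sigma> *\<^sub>R sign_mult ?z (Phi p x)) = damped_map (p - 1) d p T \<sigma> x"
    using assms z
    by (auto simp: vec_eq_iff Phi_nonneg q sign_mult_def damped_map_def less_eq_vec_def)
  then show ?thesis by (simp add: step2_def damped_step_def Let_def)
qed

lemma supp_damped_map:
  assumes "1 \<le> d" "tensor_nonneg d T" "0 \<le> x" "0 \<le> \<sigma>"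
  shows "supp (damped_map a d p T \<sigma> x) = supp (tensor_map d T x)"
proof -
  let ?z = "tensor_map d T x"
  have z: "0 \<le> ?z $ i" for i
    using tensor_map_nonneg[OF assms(1-3)] by (simp add: less_eq_vec_def)
  have "damped_map a d p T \<sigma> x $ i \<noteq> 0 \<longleftrightarrow> ?z $ i \<noteq> 0" for i
  proof (cases "?z $ i = 0")
    case False
    then have "0 < ?z $ i powr (a / (p - 1)) + \<sigma> * (sgn (?z $ i) * x $ i powr a)"
      using z[of i] assms(4) by (intro add_pos_nonneg) auto
    then show ?thesis using False by (simp add: damped_map_def)
  qed (simp add: damped_map_def)
  then show ?thesis by (simp add: supp_def)
qed

lemma damped_step_normalised:
  assumes "1 \<le> d" "tensor_nonneg d T" "0 \<le> x" "0 \<le> \<sigma>" "0 < p" "supp (tensor_map d T x) \<noteq> {}"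
  shows "supp (damped_step a d p T \<sigma> x) = supp (tensor_map d T x)"
    and "lp_norm p (damped_step a d p T \<sigma> x) = 1"
proof -
  have s: "supp (damped_map a d p T \<sigma> x) = supp (tensor_map d T x)"
    by (rule supp_damped_map) fact+
  then have pos: "0 < lp_norm p (damped_map a d p T \<sigma> x)"
    using assms(6) by (intro lp_norm_pos) auto
  then show "supp (damped_step a d p T \<sigma> x) = supp (tensor_map d T x)"
    by (simp add: damped_step_def s)
  show "lp_norm p (damped_step a d p T \<sigma> x) = 1"
    using pos assms by (simp add: damped_step_def lp_norm_scaleR)
qed

section \<open>The scalar iteration that controls the error\<close>

lemma powr_le_self:
  fixes R r :: real
  assumes "1 \<le> R" "r \<le> 1" shows "R powr r \<le> R"
  using powr_mono[OF assms(2,1)] assms(1) by simp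

text \<open>
  For \<open>R \<ge> 1\<close> the new value is a weighted mean of \<open>R\<^sup>r \<le> R\<close> and \<open>R\<close>, hence the sequence
  decreases. Its limit \<open>L \<ge> 1\<close> satisfies \<open>L\<^sup>r = L\<close>, because the first weight is positive, and
  \<open>r < 1\<close> leaves only \<open>L = 1\<close>.
\<close>
lemma tendsto_damped_powr_iteration:
  fixes R :: "nat \<Rightarrow> real"
  assumes "0 < \<kappa>" "0 \<le> \<sigma>" "0 \<le> r" "r < 1" "1 \<le> R 0"
    and step: "\<And>k. R (Suc k) = (\<kappa> * R k powr r + \<sigma> * R k) / (\<kappa> + \<sigma>)"
  shows "\<And>k. 1 \<le> R k" "R \<longlonglongrightarrow> 1"
proof -
  show ge: "1 \<le> R k" for k
  proof (induction k)
    case (Suc k)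
    have "\<kappa> * 1 + \<sigma> * 1 \<le> \<kappa> * R k powr r + \<sigma> * R k"
      using Suc assms by (intro add_mono mult_left_mono) (auto intro: ge_one_powr_ge_zero)
    then show ?case using assms by (simp add: step)
  qed (use assms in simp)
  have dec: "R (Suc k) \<le> R k" for k
  proof -
    have "\<kappa> * R k powr r + \<sigma> * R k \<le> \<kappa> * R k + \<sigma> * R k"
      using powr_le_self[OF ge, of r k] assms by (intro add_mono mult_left_mono) auto
    then show ?thesis using assms by (simp add: step divide_simps) (simp add: algebra_simps)
  qed
  then have "decseq R" by (rule decseq_SucI)
  then obtain L where L: "R \<longlonglongrightarrow> L" and "\<And>k. L \<le> R k"
    using decseq_convergent[of R 1] ge by blast
  have L1: "1 \<le> L" using L ge by (intro LIMSEQ_le_const) auto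
  have "(\<lambda>k. (\<kappa> * R k powr r + \<sigma> * R k) / (\<kappa> + \<sigma>)) \<longlonglongrightarrow> (\<kappa> * L powr r + \<sigma> * L) / (\<kappa> + \<sigma>)"
    using L L1 assms by (intro tendsto_intros) auto
  then have "(\<kappa> * L powr r + \<sigma> * L) / (\<kappa> + \<sigma>) = L"
    by (rule LIMSEQ_unique) (use LIMSEQ_Suc[OF L] step in simp)
  then have "\<kappa> * L powr r = \<kappa> * L" using assms(1,2) by (simp add: field_simps)
  then have "L powr r = L powr 1" using assms(1) L1 by simp
  moreover have "L powr r < L powr 1" if "1 < L" using that assms(4) by (rule powr_less_mono[rotated])
  ultimately have "L = 1" using L1 by fastforce
  then show "R \<longlonglongrightarrow> 1" using L by simp
qed

section \<open>Perron theory on an invariant face\<close>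

text \<open>
  Only the invariance of the zero pattern is used here, not how the pattern arises; the cone of
  \<open>T\<close> is the instance in which \<open>S\<close> is the stable support of the iterates of the all-ones vector.
\<close>
locale invariant_face =
  fixes T :: "'n::finite tensor" and d :: nat and p :: real and S :: "'n set"
  assumes d: "1 \<le> d" and nonneg: "tensor_nonneg d T" and p: "real d < p"
    and S: "S \<noteq> {}"
    and invariant: "\<And>x. 0 \<le> x \<Longrightarrow> supp x = S \<Longrightarrow> supp (tensor_map d T x) = S"
begin

definition face :: "(real ^ 'n) set" where
  "face = {x. 0 \<le> x \<and> supp x = S}"

lemma p_gt_1: "1 < p" using d p by linarith

lemma faceD: "x \<in> face \<Longrightarrow> 0 \<le> x" "x \<in> face \<Longrightarrow> supp x = S"
  by (auto simp: face_def)

lemma face_nth: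
  assumes "x \<in> face"
  shows "i \<in> S \<Longrightarrow> 0 < x $ i" "i \<notin> S \<Longrightarrow> x $ i = 0" "0 \<le> x $ i"
  using assms by (auto simp: face_def supp_def less_eq_vec_def order.order_iff_strict)

lemma tensor_map_face: "x \<in> face \<Longrightarrow> tensor_map d T x \<in> face"
  using tensor_map_nonneg[OF d nonneg] invariant by (simp add: face_def)

lemma face_comparable:
  assumes "x \<in> face" "y \<in> face"
  obtains c where "0 < c" "c *\<^sub>R x \<le> y"
  using supp_subset_iff_scaled_le[of x y] assms by (auto simp: face_def)

lemma eigenvalue_pos:
  assumes "u \<in> face" "lp_eigenpair d p T \<mu> u"
  shows "0 < \<mu>"
proof -
  obtain i where i: "i \<in> S" using S by auto
  have "0 < tensor_map d T u $ i" using face_nth(1)[OF tensor_map_face] assms(1) i by blast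
  also have "\<dots> = \<mu> * u $ i powr (p - 1)"
    using assms by (simp add: lp_eigenpair_def Phi_nonneg faceD)
  finally show ?thesis using face_nth(1)[OF assms(1) i] by (simp add: zero_less_mult_iff)
qed

text \<open>
  If \<open>T(e)\<close> were \<open>b e\<close> for the indicator \<open>e\<close> of \<open>S\<close>, then this multiple \<open>c = b\<^bsup>1/(p-d)\<^esup>\<close> of \<open>e\<close>
  would solve \<open>T(c e) = (c e)\<^bsup>p-1\<^esup>\<close> exactly. Applied to a lower and an upper bound for \<open>T(e)\<close> it
  produces a subsolution and a supersolution.
\<close>
lemma scale_solves:
  assumes "0 < b"
  shows "(b powr (1 / (p - d))) ^ (d - 1) * b = (b powr (1 / (p - d))) powr (p - 1)"
proof -
  have "(b powr (1 / (p - d))) ^ (d - 1) * b = b powr (1 / (p - d) * (d - 1) + 1)"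
    using assms d p by (simp add: powr_add powr_powr flip: powr_realpow)
  also have "1 / (p - d) * (d - 1) + 1 = 1 / (p - d) * (p - 1)"
    using d p by (simp add: field_simps of_nat_diff)
  finally show ?thesis by (simp add: powr_powr)
qed

text \<open>
  Monotone iteration: the supersolution \<open>B e\<close> generates a decreasing sequence, and the
  subsolution \<open>A e\<close> below it keeps the limit positive on \<open>S\<close>, hence in the face. Normalising
  the solution \<open>w\<close> of \<open>T(w) = w\<^bsup>p-1\<^esup>\<close> changes the eigenvalue but not the equation, since both
  sides are homogeneous.
\<close>
lemma ex_eigenpair:
  obtains u \<mu> where "u \<in> face" "lp_eigenpair d p T \<mu> u"
proof -
  note p1 = p_gt_1
  define e :: "real ^ 'n" where "e = (\<chi> i. if i \<in> S then 1 else 0)"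
  have e: "e \<in> face" by (auto simp: e_def face_def supp_def less_eq_vec_def)
  have e01: "e $ i powr s = e $ i" for i s by (simp add: e_def)
  define G where "G x = (\<chi> i. tensor_map d T x $ i powr (1 / (p - 1)))" for x
  have G_mono: "G x \<le> G y" if "0 \<le> x" "x \<le> y" for x y
    using tensor_map_mono[OF d nonneg that] tensor_map_nonneg[OF d nonneg that(1)] p1
    by (auto simp: G_def less_eq_vec_def intro!: powr_mono2)
  obtain \<alpha> where \<alpha>: "0 < \<alpha>" "\<alpha> *\<^sub>R e \<le> tensor_map d T e"
    using face_comparable[OF e tensor_map_face[OF e]] by auto
  obtain \<beta>' where \<beta>': "0 < \<beta>'" "\<beta>' *\<^sub>R tensor_map d T e \<le> e"
    using face_comparable[OF tensor_map_face[OF e] e] by auto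
  define \<beta> where "\<beta> = inverse \<beta>'"
  have \<beta>: "0 < \<beta>" "tensor_map d T e \<le> \<beta> *\<^sub>R e"
    using \<beta>' by (auto simp: \<beta>_def less_eq_vec_def field_simps)
  define A where "A = \<alpha> powr (1 / (p - d))"
  define B where "B = \<beta> powr (1 / (p - d))"
  have AB: "0 < A" "0 < B" using \<alpha>(1) \<beta>(1) by (auto simp: A_def B_def)
  have TA: "A ^ (d - 1) * \<alpha> = A powr (p - 1)" unfolding A_def by (rule scale_solves[OF \<alpha>(1)])
  have TB: "B ^ (d - 1) * \<beta> = B powr (p - 1)" unfolding B_def by (rule scale_solves[OF \<beta>(1)])
  have G_scale: "G (c *\<^sub>R e) $ i = (c ^ (d - 1) * tensor_map d T e $ i) powr (1 / (p - 1))" for c i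
    by (simp add: G_def tensor_map_scaleR)
  have root: "(c powr (p - 1) * e $ i) powr (1 / (p - 1)) = c * e $ i" if "0 < c" for c i
    using that p1 by (simp add: powr_mult powr_powr e01)
  have lower: "A *\<^sub>R e \<le> G (A *\<^sub>R e)"
    unfolding less_eq_vec_def
  proof
    fix i
    have "A ^ (d - 1) * (\<alpha> * e $ i) \<le> A ^ (d - 1) * tensor_map d T e $ i"
      using AB \<alpha>(2) by (intro mult_left_mono) (auto simp: less_eq_vec_def)
    then have "A powr (p - 1) * e $ i \<le> A ^ (d - 1) * tensor_map d T e $ i"
      by (simp flip: TA mult.assoc)
    then have "(A powr (p - 1) * e $ i) powr (1 / (p - 1)) \<le> G (A *\<^sub>R e) $ i"
      unfolding G_scale using p1 face_nth(3)[OF e] by (intro powr_mono2) auto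
    then show "(A *\<^sub>R e) $ i \<le> G (A *\<^sub>R e) $ i" using root[OF AB(1)] by simp
  qed
  have upper: "G (B *\<^sub>R e) \<le> B *\<^sub>R e"
    unfolding less_eq_vec_def
  proof
    fix i
    have "B ^ (d - 1) * tensor_map d T e $ i \<le> B ^ (d - 1) * (\<beta> * e $ i)"
      using AB \<beta>(2) by (intro mult_left_mono) (auto simp: less_eq_vec_def)
    then have "B ^ (d - 1) * tensor_map d T e $ i \<le> B powr (p - 1) * e $ i"
      by (simp flip: TB mult.assoc)
    then have "G (B *\<^sub>R e) $ i \<le> (B powr (p - 1) * e $ i) powr (1 / (p - 1))"
      unfolding G_scale using p1 AB face_nth(3)[OF tensor_map_face[OF e]]
      by (intro powr_mono2) auto
    then show "G (B *\<^sub>R e) $ i \<le> (B *\<^sub>R e) $ i" using root[OF AB(2)] by simp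
  qed
  have "A \<le> B"
  proof -
    obtain i where "i \<in> S" using S by auto
    moreover have "\<alpha> * e $ i \<le> \<beta> * e $ i"
      using order_trans[OF \<alpha>(2) \<beta>(2)] by (simp add: less_eq_vec_def)
    ultimately have "\<alpha> \<le> \<beta>" by (simp add: e_def)
    then show ?thesis unfolding A_def B_def using \<alpha>(1) p by (intro powr_mono2) auto
  qed
  then have ABe: "A *\<^sub>R e \<le> B *\<^sub>R e"
    using face_nth(3)[OF e] by (auto simp: less_eq_vec_def intro: mult_right_mono)
  have Ae: "0 \<le> A *\<^sub>R e" using AB face_nth(3)[OF e] by (auto simp: less_eq_vec_def)
  define W where "W k = (G ^^ k) (B *\<^sub>R e)" for k
  have W_Suc: "W (Suc k) = G (W k)" for k by (simp add: W_def)
  have W_low: "A *\<^sub>R e \<le> W k" for k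
  proof (induction k)
    case 0 show ?case using ABe by (simp add: W_def)
  next
    case (Suc k)
    show ?case using order_trans[OF lower G_mono[OF Ae Suc]] by (simp add: W_Suc)
  qed
  have W_nonneg: "0 \<le> W k" for k using Ae W_low order_trans by blast
  have W_dec: "W (Suc k) \<le> W k" for k
  proof (induction k)
    case 0 show ?case using upper by (simp add: W_def)
  next
    case (Suc k)
    show ?case using G_mono[OF W_nonneg Suc] by (simp add: W_Suc)
  qed
  have "\<exists>L. (\<lambda>k. W k $ i) \<longlonglongrightarrow> L" for i
  proof -
    have "decseq (\<lambda>k. W k $ i)" using W_dec by (intro decseq_SucI) (simp add: less_eq_vec_def)
    moreover have "\<And>k. (A *\<^sub>R e) $ i \<le> W k $ i" using W_low by (simp add: less_eq_vec_def)
    ultimately show ?thesis by (metis decseq_convergent)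
  qed
  then obtain w' where w': "\<And>i. (\<lambda>k. W k $ i) \<longlonglongrightarrow> w' i" by metis
  define w where "w = (\<chi> i. w' i)"
  have lim: "W \<longlonglongrightarrow> w" unfolding w_def using w' by (intro vec_tendstoI) simp
  have w_ge: "(A *\<^sub>R e) $ i \<le> w $ i" for i
    using W_low by (intro LIMSEQ_le_const[OF tendsto_vec_nth[OF lim]]) (auto simp: less_eq_vec_def)
  have w_le: "w $ i \<le> (B *\<^sub>R e) $ i" for i
  proof -
    have "W k \<le> W 0" for k
      using lift_Suc_antimono_le[of W 0 k] W_dec by simp
    then have "W k \<le> B *\<^sub>R e" for k by (simp add: W_def)
    then show ?thesis
      by (intro LIMSEQ_le_const2[OF tendsto_vec_nth[OF lim]]) (auto simp: less_eq_vec_def)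
  qed
  have w: "w \<in> face"
  proof -
    have "0 \<le> w $ i" for i using w_ge[of i] Ae by (auto simp: less_eq_vec_def intro: order_trans)
    moreover have "w $ i \<noteq> 0 \<longleftrightarrow> i \<in> S" for i
      using w_ge[of i] w_le[of i] AB calculation[of i] by (auto simp: e_def split: if_splits)
    ultimately show ?thesis by (auto simp: face_def supp_def less_eq_vec_def)
  qed
  have fixed: "w $ i powr (p - 1) = tensor_map d T w $ i" for i
  proof -
    have "tensor_map d T (W k) $ i = W (Suc k) $ i powr (p - 1)" for k
      using tensor_map_nonneg[OF d nonneg W_nonneg] p1
      by (simp add: W_Suc G_def powr_powr less_eq_vec_def)
    moreover have "(\<lambda>k. W (Suc k) $ i powr (p - 1)) \<longlonglongrightarrow> w $ i powr (p - 1)"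
      using p1 W_nonneg
      by (intro tendsto_powr' tendsto_const tendsto_vec_nth LIMSEQ_Suc[OF lim])
         (auto simp: less_eq_vec_def)
    moreover have "(\<lambda>k. tensor_map d T (W k) $ i) \<longlonglongrightarrow> tensor_map d T w $ i"
      by (intro tendsto_vec_nth tendsto_tensor_map lim)
    ultimately show ?thesis using LIMSEQ_unique by auto
  qed
  define N where "N = lp_norm p w"
  have N: "0 < N" unfolding N_def using w S by (intro lp_norm_pos) (simp add: face_def)
  define u where "u = inverse N *\<^sub>R w"
  have u: "u \<in> face" using w N by (auto simp: u_def face_def less_eq_vec_def)
  have "lp_norm p u = 1" unfolding u_def using N p1 by (simp add: lp_norm_scaleR flip: N_def)
  moreover have "tensor_map d T u = (inverse N ^ (d - 1) * N powr (p - 1)) *\<^sub>R Phi p u"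
  proof -
    have w_nth: "w $ i = N * u $ i" for i using N by (simp add: u_def)
    have "tensor_map d T u $ i = inverse N ^ (d - 1) * w $ i powr (p - 1)" for i
      by (simp add: u_def tensor_map_scaleR fixed)
    then show ?thesis
      using N face_nth(3)[OF u]
      by (simp add: Phi_nonneg[OF faceD(1)[OF u]] vec_eq_iff w_nth powr_mult)
  qed
  ultimately show ?thesis using u that unfolding lp_eigenpair_def by blast
qed

text \<open>
  Write \<open>s = m\<^sup>a\<close>. Applying \<open>T\<close> to both bounds and using \<open>T(u) = \<mu> u\<^bsup>p-1\<^esup>\<close> traps the \<open>a\<close>-th power
  of the new vector between \<open>\<phi>(s) u\<^sup>a\<close> and \<open>\<phi>(s R) u\<^sup>a\<close>, where \<open>\<phi>(t) = \<kappa> t\<^sup>r + \<sigma> t\<close>. The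
  quotient \<open>\<phi>(s R) / \<phi>(s)\<close> is a weighted mean of \<open>R\<^sup>r\<close> and \<open>R\<close>, and \<open>s \<le> 1\<close> makes the weight
  of the smaller term at least what it is for \<open>s = 1\<close>. So \<open>\<phi>(R) / \<phi>(1)\<close>, which no longer depends
  on \<open>x\<close>, is an upper bound.
\<close>
lemma damped_map_contraction:
  assumes u: "u \<in> face" "lp_eigenpair d p T \<mu> u" and x: "x \<in> face"
    and m: "0 < m" "m \<le> 1" and R: "1 \<le> R" and "0 < a" "0 \<le> \<sigma>"
    and lo: "m *\<^sub>R u \<le> x" and hi: "x \<le> (m * R powr (1 / a)) *\<^sub>R u"
  defines "\<kappa> \<equiv> \<mu> powr (a / (p - 1))" and "r \<equiv> real (d - 1) / (p - 1)"
  defines "R' \<equiv> (\<kappa> * R powr r + \<sigma> * R) / (\<kappa> + \<sigma>)"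
  obtains m' where "0 < m'" "m' *\<^sub>R u \<le> damped_map a d p T \<sigma> x"
    "damped_map a d p T \<sigma> x \<le> (m' * R' powr (1 / a)) *\<^sub>R u"
proof -
  note p1 = p_gt_1
  have \<mu>: "0 < \<mu>" using eigenvalue_pos u by blast
  then have \<kappa>: "0 < \<kappa>" by (simp add: \<kappa>_def)
  have r: "0 \<le> r" "r < 1" using d p p1 by (auto simp: r_def of_nat_diff)
  define s where "s = m powr a"
  have s: "0 < s" "s \<le> 1" using m \<open>0 < a\<close> by (auto simp: s_def powr_le1)
  define b where "b = \<kappa> * s powr r + \<sigma> * s"
  have b: "0 < b" unfolding b_def using \<kappa> s assms by (intro add_pos_nonneg) auto
  have R'0: "0 \<le> R'" using \<kappa> R assms(8) by (auto simp: R'_def)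
  have ratio: "\<kappa> * (s * R) powr r + \<sigma> * (s * R) \<le> b * R'"
  proof -
    \<comment> \<open>After clearing the denominator, this is the difference of the two sides.\<close>
    have "0 \<le> \<kappa> * \<sigma> * ((s powr r - s) * (R - R powr r))"
    proof -
      have "s \<le> s powr r" using powr_mono'[of r 1 s] r s by simp
      moreover have "R powr r \<le> R" using powr_le_self R r by simp
      ultimately show ?thesis using \<kappa> assms(8) by simp
    qed
    then have "(\<kappa> * (s powr r * R powr r) + \<sigma> * (s * R)) * (\<kappa> + \<sigma>)
        \<le> b * (\<kappa> * R powr r + \<sigma> * R)"
      unfolding b_def by (simp add: algebra_simps)
    then show ?thesis
      using \<kappa> assms(8) s R by (simp add: R'_def powr_mult pos_le_divide_eq)
  qed
  have Tu: "tensor_map d T u $ i = \<mu> * u $ i powr (p - 1)" for i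
    using u by (simp add: lp_eigenpair_def Phi_nonneg faceD)
  define y where "y = damped_map a d p T \<sigma> x"
  have power_bound: "(c ^ (d - 1) * (\<mu> * u $ i powr (p - 1))) powr (a / (p - 1))
      = \<kappa> * (c powr a) powr r * u $ i powr a" if "0 < c" for c i
    using that \<mu> p1 face_nth(3)[OF u(1), of i]
    by (simp add: powr_mult powr_powr \<kappa>_def r_def mult_ac flip: powr_realpow)
  have "0 \<le> m *\<^sub>R u" using m face_nth(3)[OF u(1)] by (auto simp: less_eq_vec_def)
  note z_lo = tensor_map_mono[OF d nonneg this lo]
  note z_hi = tensor_map_mono[OF d nonneg faceD(1)[OF x] hi]
  have bounds: "b powr (1 / a) * u $ i \<le> y $ i \<and> y $ i \<le> b powr (1 / a) * R' powr (1 / a) * u $ i" for i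
  proof (cases "i \<in> S")
    case False
    then have "u $ i = 0" "tensor_map d T x $ i = 0"
      using face_nth(2) u(1) x tensor_map_face by blast+
    then show ?thesis by (simp add: y_def damped_map_def)
  next
    case True
    define z where "z = tensor_map d T x $ i"
    have pos: "0 < u $ i" "0 < x $ i" "0 < z"
      using True face_nth(1) u(1) x tensor_map_face unfolding z_def by blast+
    define Y where "Y = z powr (a / (p - 1)) + \<sigma> * x $ i powr a"
    have y: "y $ i = Y powr (1 / a)"
      using pos by (simp add: y_def damped_map_def Y_def flip: z_def)
    have c: "0 < m * R powr (1 / a)" using m R by simp
    have sR: "(m * R powr (1 / a)) powr a = s * R"
      using m R \<open>0 < a\<close> by (simp add: powr_mult powr_powr s_def)
    have zl: "m ^ (d - 1) * (\<mu> * u $ i powr (p - 1)) \<le> z"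
      using z_lo by (simp add: less_eq_vec_def tensor_map_scaleR Tu z_def)
    have zh: "z \<le> (m * R powr (1 / a)) ^ (d - 1) * (\<mu> * u $ i powr (p - 1))"
      using z_hi unfolding less_eq_vec_def tensor_map_scaleR z_def by (simp add: Tu)
    have xl: "s * u $ i powr a \<le> x $ i powr a"
    proof -
      have "(m * u $ i) powr a \<le> x $ i powr a"
        using lo pos m \<open>0 < a\<close> by (intro powr_mono2) (auto simp: less_eq_vec_def)
      then show ?thesis using m pos by (simp add: powr_mult s_def)
    qed
    have xh: "x $ i powr a \<le> s * R * u $ i powr a"
    proof -
      have "x $ i powr a \<le> (m * R powr (1 / a) * u $ i) powr a"
        using hi pos \<open>0 < a\<close> by (intro powr_mono2) (auto simp: less_eq_vec_def)
      also have "\<dots> = s * R * u $ i powr a" using c pos sR by (simp only: powr_mult)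
      finally show ?thesis .
    qed
    have "\<kappa> * s powr r * u $ i powr a \<le> z powr (a / (p - 1))"
      unfolding s_def power_bound[OF m(1), symmetric]
      using zl \<open>0 < a\<close> p1 m \<mu> by (intro powr_mono2) auto
    moreover have "\<sigma> * (s * u $ i powr a) \<le> \<sigma> * x $ i powr a"
      using xl assms(8) by (rule mult_left_mono)
    ultimately have Yl: "b * u $ i powr a \<le> Y" by (simp add: Y_def b_def algebra_simps)
    have "z powr (a / (p - 1)) \<le> \<kappa> * (s * R) powr r * u $ i powr a"
      unfolding sR[symmetric] power_bound[OF c, symmetric]
      using zh \<open>0 < a\<close> p1 pos by (intro powr_mono2) auto
    moreover have "\<sigma> * x $ i powr a \<le> \<sigma> * (s * R * u $ i powr a)"
      using xh assms(8) by (rule mult_left_mono)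
    ultimately have "Y \<le> (\<kappa> * (s * R) powr r + \<sigma> * (s * R)) * u $ i powr a"
      by (simp add: Y_def algebra_simps)
    also have "\<dots> \<le> b * R' * u $ i powr a" using ratio by (rule mult_right_mono) simp
    finally have Yh: "Y \<le> b * R' * u $ i powr a" .
    have root: "(c * u $ i powr a) powr (1 / a) = c powr (1 / a) * u $ i" if "0 \<le> c" for c
      using that pos \<open>0 < a\<close> by (simp add: powr_mult powr_powr)
    have Y0: "0 \<le> Y" using b order_trans[OF _ Yl, of 0] by simp
    have "(b * u $ i powr a) powr (1 / a) \<le> y $ i"
      unfolding y using Yl b \<open>0 < a\<close> by (intro powr_mono2) auto
    moreover have "y $ i \<le> (b * R' * u $ i powr a) powr (1 / a)"
      unfolding y using Yh Y0 \<open>0 < a\<close> by (intro powr_mono2) auto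
    ultimately show ?thesis
      using b R'0 root[of b] root[of "b * R'"] by (simp add: powr_mult[of b R'])
  qed
  show ?thesis
    by (rule that[of "b powr (1 / a)"]) (use b bounds in \<open>auto simp: less_eq_vec_def y_def\<close>)
qed

text \<open>
  Equal norms pin the two factors to either side of 1. This supplies the hypothesis \<open>m \<le> 1\<close> of
  the contraction and later turns a ratio close to 1 into factors that are both close to 1.
\<close>
lemma normalised_bounds:
  assumes "u \<in> face" "lp_norm p u = 1" "x \<in> face" "lp_norm p x = 1"
    and "0 \<le> m" "m *\<^sub>R u \<le> x" "x \<le> M *\<^sub>R u"
  shows "m \<le> 1" "1 \<le> M"
proof -
  have p0: "0 < p" using p_gt_1 by simp
  have "0 \<le> m *\<^sub>R u" using assms face_nth(3) by (auto simp: less_eq_vec_def)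
  from lp_norm_mono[OF p0 this assms(6)] show "m \<le> 1" using assms p0 by (simp add: lp_norm_scaleR)
  obtain i where i: "i \<in> S" using S by auto
  have "0 < x $ i" "x $ i \<le> M * u $ i" "0 < u $ i"
    using face_nth(1) i assms by (auto simp: less_eq_vec_def)
  then have "0 \<le> M" by (metis less_le_trans less_imp_le zero_less_mult_pos2)
  with lp_norm_mono[OF p0 faceD(1)[OF assms(3)] assms(7)] show "1 \<le> M"
    using assms p0 by (simp add: lp_norm_scaleR)
qed

lemma damped_step_face:
  assumes "x \<in> face" "0 \<le> \<sigma>"
  shows "damped_step a d p T \<sigma> x \<in> face" "lp_norm p (damped_step a d p T \<sigma> x) = 1"
proof -
  have "supp (tensor_map d T x) = S" using tensor_map_face[OF assms(1)] by (simp add: face_def)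
  then show "damped_step a d p T \<sigma> x \<in> face" "lp_norm p (damped_step a d p T \<sigma> x) = 1"
    using damped_step_normalised[OF d nonneg faceD(1)[OF assms(1)] assms(2), of p a] p_gt_1 S
      damped_step_nonneg[of a d p T \<sigma> x] by (auto simp: face_def)
qed

text \<open>
  The two factors are followed as \<open>m\<close> and \<open>m R\<^bsup>1/a\<^esup>\<close>, because normalisation rescales both by the
  same amount and leaves \<open>R\<close> alone. From \<open>m \<le> 1 \<le> m R\<^bsup>1/a\<^esup>\<close> the iterate lies between
  \<open>R\<^bsup>-1/a\<^esup> u\<close> and \<open>R\<^bsup>1/a\<^esup> u\<close>, and \<open>R\<close> tends to 1.
\<close>
lemma damped_iteration_converges:
  assumes u: "u \<in> face" "lp_eigenpair d p T \<mu> u" and "0 < a" "0 \<le> \<sigma>"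
    and x0: "x 0 \<in> face" "lp_norm p (x 0) = 1"
    and x_Suc: "\<And>k. x (Suc k) = damped_step a d p T \<sigma> (x k)"
  shows "x \<longlonglongrightarrow> u"
proof -
  note p1 = p_gt_1
  have nu: "lp_norm p u = 1" using u by (simp add: lp_eigenpair_def)
  have xk: "x k \<in> face \<and> lp_norm p (x k) = 1" for k
    by (induction k) (use x0 damped_step_face assms(4) x_Suc in auto)
  define \<kappa> where "\<kappa> = \<mu> powr (a / (p - 1))"
  define r where "r = real (d - 1) / (p - 1)"
  have r: "0 \<le> r" "r < 1" using d p p1 by (auto simp: r_def of_nat_diff)
  have \<kappa>: "0 < \<kappa>" using eigenvalue_pos[OF u] by (simp add: \<kappa>_def)
  obtain m0 where m0: "0 < m0" "m0 *\<^sub>R u \<le> x 0" using face_comparable[OF u(1) x0(1)] .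
  obtain c where c: "0 < c" "c *\<^sub>R x 0 \<le> u" using face_comparable[OF x0(1) u(1)] .
  have hi0: "x 0 \<le> inverse c *\<^sub>R u" using c by (auto simp: less_eq_vec_def field_simps)
  note nb0 = normalised_bounds[OF u(1) nu x0 less_imp_le[OF m0(1)] m0(2) hi0]
  define R0 where "R0 = (inverse c / m0) powr a"
  define R where "R k = ((\<lambda>t. (\<kappa> * t powr r + \<sigma> * t) / (\<kappa> + \<sigma>)) ^^ k) R0" for k
  have R_Suc: "R (Suc k) = (\<kappa> * R k powr r + \<sigma> * R k) / (\<kappa> + \<sigma>)" for k by (simp add: R_def)
  have "1 \<le> R 0"
  proof -
    have "1 \<le> inverse c / m0" using nb0 m0 by (simp add: pos_le_divide_eq)
    then show ?thesis using \<open>0 < a\<close> by (auto simp: R_def R0_def intro: ge_one_powr_ge_zero)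
  qed
  note R = tendsto_damped_powr_iteration[where R = R, OF \<kappa> assms(4) r this R_Suc]
  have close: "\<exists>m>0. m *\<^sub>R u \<le> x k \<and> x k \<le> (m * R k powr (1 / a)) *\<^sub>R u" for k
  proof (induction k)
    case 0
    have "m0 * R 0 powr (1 / a) = inverse c"
      using m0 c \<open>0 < a\<close> by (simp add: R_def R0_def powr_powr)
    then show ?case using m0 hi0 by auto
  next
    case (Suc k)
    then obtain m where m: "0 < m" "m *\<^sub>R u \<le> x k" "x k \<le> (m * R k powr (1 / a)) *\<^sub>R u" by auto
    note m1 = normalised_bounds(1)[OF u(1) nu conjunct1[OF xk] conjunct2[OF xk]
        less_imp_le[OF m(1)] m(2,3)]
    let ?y = "damped_map a d p T \<sigma> (x k)"
    obtain m' where m': "0 < m'" "m' *\<^sub>R u \<le> ?y" "?y \<le> (m' * R (Suc k) powr (1 / a)) *\<^sub>R u"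
      using damped_map_contraction[OF u conjunct1[OF xk] m(1) m1 R(1) assms(3,4) m(2,3)]
      unfolding R_Suc \<kappa>_def r_def by blast
    have xe: "x (Suc k) = inverse (lp_norm p ?y) *\<^sub>R ?y" by (simp add: x_Suc damped_step_def)
    have "supp ?y = S"
      using supp_damped_map[OF d nonneg faceD(1) assms(4)] tensor_map_face xk faceD(2) by metis
    then have N: "0 < lp_norm p ?y" using S by (intro lp_norm_pos) auto
    show ?case
      using m' N unfolding xe
      by (intro exI[of _ "inverse (lp_norm p ?y) * m'"])
         (auto simp: less_eq_vec_def mult.assoc)
  qed
  have sandwich: "inverse (R k powr (1 / a)) * u $ i \<le> x k $ i \<and> x k $ i \<le> R k powr (1 / a) * u $ i" for k i
  proof -
    obtain m where m: "0 < m" "m *\<^sub>R u \<le> x k" "x k \<le> (m * R k powr (1 / a)) *\<^sub>R u"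
      using close by blast
    note nb = normalised_bounds[OF u(1) nu conjunct1[OF xk] conjunct2[OF xk]
        less_imp_le[OF m(1)] m(2,3)]
    have Rp: "0 < R k powr (1 / a)" using R(1)[of k] by simp
    have ui: "0 \<le> u $ i" using face_nth(3) u by blast
    have "inverse (R k powr (1 / a)) \<le> m" using nb(2) Rp by (simp add: field_simps)
    then have "inverse (R k powr (1 / a)) * u $ i \<le> m * u $ i" using ui by (rule mult_right_mono)
    also have "\<dots> \<le> x k $ i" using m by (simp add: less_eq_vec_def)
    finally have 1: "inverse (R k powr (1 / a)) * u $ i \<le> x k $ i" .
    have "x k $ i \<le> (m * R k powr (1 / a)) * u $ i" using m(3) by (simp add: less_eq_vec_def)
    also have "\<dots> \<le> R k powr (1 / a) * u $ i"
      using nb(1) Rp ui m(1) by (intro mult_right_mono) auto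
    finally show ?thesis using 1 by simp
  qed
  have lim: "(\<lambda>k. R k powr (1 / a)) \<longlonglongrightarrow> 1"
    using tendsto_powr[OF R(2) tendsto_const[of "1 / a"]] by simp
  show ?thesis
  proof (rule vec_tendstoI)
    fix i
    have l1: "(\<lambda>k. inverse (R k powr (1 / a)) * u $ i) \<longlonglongrightarrow> u $ i"
      using tendsto_mult[OF tendsto_inverse[OF lim] tendsto_const[of "u $ i"]] by simp
    have l2: "(\<lambda>k. R k powr (1 / a) * u $ i) \<longlonglongrightarrow> u $ i"
      using tendsto_mult[OF lim tendsto_const[of "u $ i"]] by simp
    show "(\<lambda>k. x k $ i) \<longlonglongrightarrow> u $ i"
      by (rule real_tendsto_sandwich[OF _ _ l1 l2]) (use sandwich in auto)
  qed
qed

text \<open>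
  Without damping an eigenvector is only rescaled, and normalisation undoes that. Together with
  the convergence to any given eigenvector this yields uniqueness.
\<close>
lemma eigenvector_fixed:
  assumes "v \<in> face" "lp_eigenpair d p T \<mu> v"
  shows "damped_step (p - 1) d p T 0 v = v"
proof -
  note p1 = p_gt_1
  have \<mu>: "0 < \<mu>" using eigenvalue_pos assms by blast
  define c where "c = \<mu> powr (1 / (p - 1))"
  have "damped_map (p - 1) d p T 0 v = c *\<^sub>R v"
    using assms p1 \<mu> face_nth(3)[OF assms(1)]
    by (auto simp: damped_map_def vec_eq_iff lp_eigenpair_def Phi_nonneg faceD powr_mult powr_powr c_def)
  moreover have "0 < c" using \<mu> by (simp add: c_def)
  ultimately show ?thesis
    using assms p1 by (simp add: damped_step_def lp_norm_scaleR lp_eigenpair_def)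
qed

lemma eigenvector_unique:
  assumes "u \<in> face" "lp_eigenpair d p T \<mu> u" "v \<in> face" "lp_eigenpair d p T \<nu> v"
  shows "u = v"
proof -
  have "(\<lambda>_. v) \<longlonglongrightarrow> u"
    by (rule damped_iteration_converges[OF assms(1,2), of "p - 1" 0])
       (use assms(3,4) eigenvector_fixed[OF assms(3,4)] p_gt_1 in \<open>simp_all add: lp_eigenpair_def\<close>)
  then show ?thesis by (simp add: LIMSEQ_const_iff)
qed

end

section \<open>Convergence of both algorithms\<close>

text \<open>
  The damping term is switched off by the sign where \<open>T(x)\<close> vanishes, so a step has the zero
  pattern of \<open>T(x)\<close>. A positive start therefore runs through the supports of the iterates of
  the all-ones vector and enters the cone after \<open>k_zero\<close> steps.
\<close>
lemma supp_damped_iteration: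
  assumes "1 \<le> d" "tensor_nonneg d T" "0 \<le> \<sigma>" "0 < p" "\<And>i. 0 < x 0 $ i"
    and nonempty: "\<And>k. supp ((tensor_map d T ^^ k) 1) \<noteq> {}"
    and x_Suc: "\<And>k. x (Suc k) = damped_step a d p T \<sigma> (x k)"
  shows "0 \<le> x k \<and> supp (x k) = supp ((tensor_map d T ^^ k) 1)"
proof (induction k)
  case 0
  show ?case using assms(5) by (auto simp: less_eq_vec_def supp_def less_imp_le less_imp_neq[symmetric])
next
  case (Suc k)
  have "supp (tensor_map d T (x k)) = supp ((tensor_map d T ^^ Suc k) 1)"
    using Suc supp_tensor_map_mono[OF assms(1,2), of "x k" "(tensor_map d T ^^ k) 1"]
      supp_tensor_map_mono[OF assms(1,2), of "(tensor_map d T ^^ k) 1" "x k"]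
      tensor_map_funpow_nonneg[OF assms(1,2)] by auto
  moreover note nonempty[of "Suc k"]
  ultimately show ?case
    using damped_step_normalised(1)[OF assms(1,2) conjunct1[OF Suc] assms(3,4), of a]
      damped_step_nonneg[of a d p T \<sigma> "x k"] by (simp add: x_Suc)
qed

theorem theorem2:
  fixes T :: "'n::finite tensor" and d :: nat and p :: real
  assumes "1 \<le> d"
    and "tensor_nonneg d T"
    and "tensor_nonzero d T"
    and "real d < p"
    and "C_plus d T \<noteq> {0}"
  shows "(\<exists>!u. u \<in> C_plus d T \<and> (\<exists>\<mu>. lp_eigenpair d p T \<mu> u)) \<and>
    (\<forall>u \<mu>. u \<in> C_plus d T \<and> lp_eigenpair d p T \<mu> u \<longrightarrow>
       0 < \<mu> \<and>
       (\<forall>\<sigma> x\<^sub>0 x l. \<forall>step \<in> {step1 d p T \<sigma>, step2 d p T \<sigma>}.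
          0 \<le> \<sigma> \<and> (\<forall>i. 0 < x\<^sub>0 $ i) \<and>
          x 0 = x\<^sub>0 \<and> (\<forall>k. x (Suc k) = step (x k) \<and> l (Suc k) = f_quot d p T (x (Suc k))) \<longrightarrow>
          (\<forall>k \<ge> k_zero d T. x k \<in> C_plus d T) \<and>
          x \<longlonglongrightarrow> u \<and>
          l \<longlonglongrightarrow> \<mu>))"
proof -
  note dT = assms(1,2)
  define k0 where "k0 = k_zero d T"
  have k0: "1 \<le> k0" using k_zero_C_plus_nonempty[OF dT] by (simp add: k0_def)
  define S where "S = supp ((tensor_map d T ^^ k0) 1)"
  have cone: "x \<in> C_plus d T \<longleftrightarrow> 0 \<le> x \<and> supp x = S" for x
    unfolding S_def k0_def by (rule C_plus_iff_supp[OF dT])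
  have stable: "supp ((tensor_map d T ^^ k) 1) = S" if "k0 \<le> k" for k
    unfolding S_def k0_def by (rule supp_funpow_stable[OF dT that[unfolded k0_def]])
  have S: "S \<noteq> {}"
  proof -
    obtain x where "x \<in> C_plus d T" "x \<noteq> 0" using k_zero_C_plus_nonempty(2)[OF dT] assms(5) by blast
    then show ?thesis using cone by (auto simp: supp_def vec_eq_iff)
  qed
  have nonempty: "supp ((tensor_map d T ^^ k) 1) \<noteq> {}" for k
    using supp_funpow_antimono[OF dT, of k "max k k0"] stable[of "max k k0"] S by auto
  interpret invariant_face T d p S
  proof
    fix x :: "real ^ 'n" assume x: "0 \<le> x" "supp x = S"
    have "supp (tensor_map d T x) = supp (tensor_map d T ((tensor_map d T ^^ k0) 1))"
      using x supp_tensor_map_mono[OF dT, of x "(tensor_map d T ^^ k0) 1"]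
        supp_tensor_map_mono[OF dT, of "(tensor_map d T ^^ k0) 1" x]
        tensor_map_funpow_nonneg[OF dT] stable[of k0] by auto
    also have "\<dots> = S" using stable[of "Suc k0"] by simp
    finally show "supp (tensor_map d T x) = S" .
  qed (use assms S in auto)
  have C: "C_plus d T = face" using cone by (auto simp: face_def)
  have ex1: "\<exists>!u. u \<in> C_plus d T \<and> (\<exists>\<mu>. lp_eigenpair d p T \<mu> u)"
    unfolding C using ex_eigenpair eigenvector_unique by metis
  have conv: "(\<forall>k\<ge>k_zero d T. x k \<in> C_plus d T) \<and> x \<longlonglongrightarrow> u \<and> l \<longlonglongrightarrow> \<mu>"
    if u: "u \<in> face" "lp_eigenpair d p T \<mu> u" and st: "step \<in> {step1 d p T \<sigma>, step2 d p T \<sigma>}"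
      and \<sigma>: "0 \<le> \<sigma>" and pos: "\<And>i. 0 < x 0 $ i"
      and it: "\<And>k. x (Suc k) = step (x k)" "\<And>k. l (Suc k) = f_quot d p T (x (Suc k))"
    for u \<mu> \<sigma> step and x :: "nat \<Rightarrow> real ^ 'n" and l
  proof -
    obtain a where a: "0 < a" and step: "\<And>y. 0 \<le> y \<Longrightarrow> step y = damped_step a d p T \<sigma> y"
      using st step1_eq_damped_step[OF dT _ p_gt_1 \<sigma>] step2_eq_damped_step[OF dT _ p_gt_1 \<sigma>] p_gt_1
      by (metis diff_gt_0_iff_gt insertE singletonD zero_less_one)
    have nn: "0 \<le> x k" for k
    proof (induction k)
      case 0 show ?case using pos by (auto simp: less_eq_vec_def less_imp_le)
    next
      case (Suc k) then show ?case by (simp add: it step damped_step_nonneg)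
    qed
    have x_Suc: "x (Suc k) = damped_step a d p T \<sigma> (x k)" for k by (simp add: it(1) step nn)
    have p0: "0 < p" using p_gt_1 by simp
    have sx: "0 \<le> x k \<and> supp (x k) = supp ((tensor_map d T ^^ k) 1)" for k
      by (rule supp_damped_iteration[OF dT \<sigma> p0 pos nonempty x_Suc])
    have inC: "x k \<in> face" if "k0 \<le> k" for k using sx stable[OF that] by (simp add: face_def)
    have norm: "lp_norm p (x k) = 1" if k: "1 \<le> k" for k
    proof -
      obtain j where j: "k = Suc j" using k by (cases k) auto
      have "supp (damped_map a d p T \<sigma> (x j)) \<noteq> {}"
        using sx[of "Suc j"] nonempty[of "Suc j"] unfolding x_Suc damped_step_def supp_def by auto
      then have "supp (tensor_map d T (x j)) \<noteq> {}"
        using supp_damped_map[OF dT nn \<sigma>] by metis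
      then show ?thesis
        using damped_step_normalised(2)[OF dT nn \<sigma> p0] by (simp add: j x_Suc)
    qed
    have "(\<lambda>k. x (k + k0)) \<longlonglongrightarrow> u"
      by (rule damped_iteration_converges[OF u a \<sigma>]) (use inC norm k0 x_Suc in auto)
    then have lim: "x \<longlonglongrightarrow> u" by (rule LIMSEQ_offset)
    have "(\<lambda>k. f_quot d p T (x k)) \<longlonglongrightarrow> f_quot d p T u"
      using u norm by (intro tendsto_f_quot lim)
        (auto simp: lp_eigenpair_def eventually_sequentially)
    then have "(\<lambda>k. l (Suc k)) \<longlonglongrightarrow> \<mu>"
      using f_quot_eigenpair[OF u(2) faceD(1)[OF u(1)] p0] LIMSEQ_Suc by (fastforce simp: it(2))
    then have "l \<longlonglongrightarrow> \<mu>" by (rule LIMSEQ_imp_Suc)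
    with lim inC show ?thesis by (simp add: C k0_def)
  qed
  show ?thesis
  proof (intro conjI[OF ex1] allI impI, goal_cases)
    case (1 u \<mu>)
    then have u: "u \<in> face" "lp_eigenpair d p T \<mu> u" by (simp_all add: C)
    show ?case
    proof (intro conjI[OF eigenvalue_pos[OF u]] allI ballI impI, goal_cases)
      case (1 \<sigma> x\<^sub>0 x l step)
      then show ?case by (intro conv[OF u, of step \<sigma>]) simp_all
    qed
  qed
qed

end
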